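(* Let $\lambda\in\mathbb{R}$, $\lambda\ne1$, $\gamma=\frac{2}{\lambda-1}$. Let $u$ be a solution of $m_t+um_\theta+\lambda u_\theta m=0$, $m=\sigma-u_{\theta\theta}$, $\sigma=\int_{S^1}u(t,\theta)\,d\theta$, with initial condition $u_0\in C^2(S^1)$, let $\eta$ be its flow, and let $m_0=\sigma-u_0''$. Set $$x(t,\theta)=\eta_\theta(t,\theta)^{1/\gamma},\qquad y(t,\theta)=-\gamma x_\theta(t,\theta)+\sigma x(t,\theta)\int_0^tx(\tau,\theta)^\gamma\,d\tau,$$ so that $x_{tt}=Fx$ and $y_{tt}=Fy$ for a common function $F(t,\theta)$. Then the angular momentum of this system is conserved in time, and is given by $$x(t,\theta)y_t(t,\theta)-y(t,\theta)x_t(t,\theta)=\eta_\theta(t,\theta)^\lambda\,m\big(t,\eta(t,\theta)\big)=m_0(\theta).$$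
   Context: $S^1=\mathbb{R}/\mathbb{Z}$. The flow is defined by $\eta_t(t,\theta)=u(t,\eta(t,\theta))$, $\eta(0,\theta)=\theta$, considered on a time interval on which $u(t,\cdot)\in C^2(S^1)$ and $\eta(t,\cdot)$ is a $C^2$ diffeomorphism with $\eta_\theta>0$. For $C^2$ solutions the PDE is understood in the integrated form $u_{t\theta}+uu_{\theta\theta}+\frac{\lambda-1}{2}u_\theta^2-\lambda\sigma u=I(t)$ with $I(t)=\frac{\lambda-3}{2}E(t)-\lambda\sigma^2$, $E(t)=\int_{S^1}u_\theta(t,\theta)^2\,d\theta$, and $\sigma$ constant in time. The function $F$ is $F(t,\theta)=\frac{\lambda-1}{2}\big[\lambda\sigma(\eta_t(t,\theta)-\sigma)+\frac{\lambda-3}{2}E(t)\big]$. *)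

theory Defs
  imports "HOL-Analysis.Analysis"
begin

text \<open>
  Functions on the circle $S^1 = \mathbb{R}/\mathbb{Z}$ are represented by 1-periodic functions on
  the real line, and orientation-preserving maps of the circle by their lifts \<open>f\<close>, which satisfy
  \<open>f (\<theta> + 1) = f \<theta> + 1\<close>.  Time-dependent functions take the time as first argument.
  Time derivatives are taken within the time interval \<open>J\<close>, hence one-sided at its endpoints.
\<close>

definition partial_t :: "real set \<Rightarrow> (real \<Rightarrow> real \<Rightarrow> real) \<Rightarrow> real \<Rightarrow> real \<Rightarrow> real"
  where "partial_t J f t \<theta> = vector_derivative (\<lambda>s. f s \<theta>) (at t within J)"

definition partial_th :: "(real \<Rightarrow> real \<Rightarrow> real) \<Rightarrow> real \<Rightarrow> real \<Rightarrow> real"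
  where "partial_th f t \<theta> = deriv (f t) \<theta>"

definition diff_t :: "real set \<Rightarrow> (real \<Rightarrow> real \<Rightarrow> real) \<Rightarrow> bool"
  where "diff_t J f \<longleftrightarrow> (\<forall>t\<in>J. \<forall>\<theta>. (\<lambda>s. f s \<theta>) differentiable (at t within J))"

definition C2 :: "(real \<Rightarrow> real) \<Rightarrow> bool"
  where "C2 f \<longleftrightarrow> f differentiable_on UNIV \<and> deriv f differentiable_on UNIV
           \<and> continuous_on UNIV (deriv (deriv f))"

definition C2_circle :: "(real \<Rightarrow> real) \<Rightarrow> bool"
  where "C2_circle f \<longleftrightarrow> C2 f \<and> (\<forall>\<theta>. f (\<theta> + 1) = f \<theta>)"

definition C2_circle_diffeo :: "(real \<Rightarrow> real) \<Rightarrow> bool"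
  where "C2_circle_diffeo f \<longleftrightarrow> bij f \<and> C2 f \<and> C2 (inv f) \<and> (\<forall>\<theta>. f (\<theta> + 1) = f \<theta> + 1)"

definition energy :: "(real \<Rightarrow> real \<Rightarrow> real) \<Rightarrow> real \<Rightarrow> real"
  where "energy u t = integral {0..1} (\<lambda>\<theta>. (partial_th u t \<theta>)\<^sup>2)"

text \<open>
  Solutions of $m_t + u m_\theta + \lambda u_\theta m = 0$, $m = \sigma - u_{\theta\theta}$,
  $\sigma = \int_{S^1} u\,d\theta$, of class $C^2$ in space.  As $m$ is merely continuous, the
  equation is imposed in its once integrated form
  $u_{t\theta} + u u_{\theta\theta} + \frac{\lambda-1}{2} u_\theta^2 - \lambda\sigma u = I(t)$.
  The three continuity conditions say that $t \mapsto u(t,\cdot)$ is a continuous curve in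
  $C^2(S^1)$.  The mixed derivative is written $\partial_t \partial_\theta u$; this is no
  restriction, since \<open>u t\<close> is recovered from its mean \<open>\<sigma>\<close> and from $u_\theta$ by
  integration in space, so that $u_t$ exists and $\partial_\theta \partial_t u$ is the same function.
\<close>

definition mu_solution :: "real \<Rightarrow> real \<Rightarrow> real set \<Rightarrow> (real \<Rightarrow> real \<Rightarrow> real) \<Rightarrow> bool"
  where "mu_solution lam \<sigma> J u \<longleftrightarrow>
    (\<forall>t\<in>J. C2_circle (u t)) \<and>
    continuous_on (J \<times> UNIV) (\<lambda>(t, \<theta>). u t \<theta>) \<and>
    continuous_on (J \<times> UNIV) (\<lambda>(t, \<theta>). partial_th u t \<theta>) \<and>
    continuous_on (J \<times> UNIV) (\<lambda>(t, \<theta>). partial_th (partial_th u) t \<theta>) \<and>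
    (\<forall>t\<in>J. integral {0..1} (u t) = \<sigma>) \<and>
    diff_t J (partial_th u) \<and>
    (\<forall>t\<in>J. \<forall>\<theta>.
      partial_t J (partial_th u) t \<theta> + u t \<theta> * partial_th (partial_th u) t \<theta>
        + (lam - 1) / 2 * (partial_th u t \<theta>)\<^sup>2 - lam * \<sigma> * u t \<theta>
      = (lam - 3) / 2 * energy u t - lam * \<sigma>\<^sup>2)"

definition circle_flow ::
    "real set \<Rightarrow> (real \<Rightarrow> real \<Rightarrow> real) \<Rightarrow> (real \<Rightarrow> real \<Rightarrow> real) \<Rightarrow> bool"
  where "circle_flow J u \<eta> \<longleftrightarrow>
    (\<forall>\<theta>. \<eta> 0 \<theta> = \<theta>) \<and>
    (\<forall>t\<in>J. \<forall>\<theta>. ((\<lambda>s. \<eta> s \<theta>) has_real_derivative u t (\<eta> t \<theta>)) (at t within J)) \<and>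
    (\<forall>t\<in>J. C2_circle_diffeo (\<eta> t)) \<and>
    (\<forall>t\<in>J. \<forall>\<theta>. partial_th \<eta> t \<theta> > 0)"

end

theory Submission
  imports Defs
begin

text \<open>
  Along the flow all quantities obey ordinary differential equations in time, and the whole proof
  consists in finding them although \<open>u\<close> is only of class $C^2$ in space, so that neither the
  equation for \<open>m\<close> nor third derivatives of the flow are available.

  Write \<open>v = u\<^sub>\<theta>(t, \<eta>)\<close>.  Then \<open>\<eta>\<^sub>\<theta>\<close> solves \<open>\<partial>\<^sub>t \<eta>\<^sub>\<theta> = v \<eta>\<^sub>\<theta>\<close> (\<open>ln_eta1_t\<close>), and the integrated
  equation says precisely \<open>\<partial>\<^sub>t v = I + \<lambda> \<sigma> u(t, \<eta>) - (\<lambda> - 1)/2 v\<^sup>2\<close> (\<open>u1_along_t\<close>): the term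
  $u u_{\theta\theta}$ is absorbed by the chain rule.  With $c = 1/\gamma = (\lambda - 1)/2$ the power \<open>x = \<eta>\<^sub>\<theta>\<^sup>c\<close>
  satisfies \<open>x\<^sub>t = c v x\<close>, and the quadratic terms cancel in \<open>x\<^sub>t\<^sub>t = c (I + \<lambda> \<sigma> \<eta>\<^sub>t) x = F x\<close>.

  Both equations, for \<open>ln \<eta>\<^sub>\<theta>\<close> and for \<open>v\<close>, have right-hand sides that are \<open>C\<^sup>1\<close> in space.
  They may therefore be differentiated in \<open>\<theta>\<close> after integration in time
  (\<open>has_real_derivative_swap\<close>), which loses no regularity and gives
  \<open>\<partial>\<^sub>t (\<eta>\<^sub>\<theta>\<^sub>\<theta> / \<eta>\<^sub>\<theta>) = w\<close> and \<open>\<partial>\<^sub>t w = \<lambda> \<sigma> v \<eta>\<^sub>\<theta> - (\<lambda> - 1) v w\<close> for \<open>w = u\<^sub>\<theta>\<^sub>\<theta>(t, \<eta>) \<eta>\<^sub>\<theta>\<close>.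
  The second of these replaces the equation for \<open>m\<close>: it says that
  \<open>\<eta>\<^sub>\<theta>\<^sup>\<lambda> m(t, \<eta>) = \<eta>\<^sub>\<theta> powr (\<lambda> - 1) * (\<sigma> \<eta>\<^sub>\<theta> - w)\<close> is constant in time
  (\<open>transported_momentum_constant\<close>).

  Since \<open>-\<gamma> x\<^sub>\<theta> = -x \<eta>\<^sub>\<theta>\<^sub>\<theta> / \<eta>\<^sub>\<theta>\<close> and \<open>x\<^sup>\<gamma> = \<eta>\<^sub>\<theta>\<close>, one has \<open>y = x z\<close> with
  \<open>z\<^sub>t = \<sigma> \<eta>\<^sub>\<theta> - w = \<eta>\<^sub>\<theta> m(t, \<eta>)\<close>.  This is reduction of order: the angular momentum is
  \<open>x y\<^sub>t - y x\<^sub>t = x\<^sup>2 z\<^sub>t = \<eta>\<^sub>\<theta>\<^sup>\<lambda> m(t, \<eta>)\<close>, and its constancy is the equation \<open>y\<^sub>t\<^sub>t = F y\<close>.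
\<close>

section \<open>Functions on a strip of space-time\<close>

text \<open>By periodicity only the compact rectangle over one period matters.\<close>

lemma bounded_time_strip:
  fixes f :: "real \<Rightarrow> real \<Rightarrow> real"
  assumes cont: "continuous_on ({a..b} \<times> UNIV) (\<lambda>(t, \<theta>). f t \<theta>)"
    and per: "\<And>t \<theta>. t \<in> {a..b} \<Longrightarrow> f t (\<theta> + 1) = f t \<theta>"
  shows "\<exists>K>0. \<forall>t\<in>{a..b}. \<forall>\<theta>. \<bar>f t \<theta>\<bar> \<le> K"
proof -
  have per_nat: "f t (\<theta> + real n) = f t \<theta>" if "t \<in> {a..b}" for t \<theta> n
  proof (induction n)
    case (Suc n)
    have "f t (\<theta> + real (Suc n)) = f t ((\<theta> + real n) + 1)" by (simp add: algebra_simps)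
    then show ?case using per[OF that, of "\<theta> + real n"] Suc by simp
  qed simp
  have per_int: "f t (\<theta> + of_int k) = f t \<theta>" if "t \<in> {a..b}" for t \<theta> k
  proof (cases "k \<ge> 0")
    case True
    then show ?thesis using per_nat[OF that, of \<theta> "nat k"] by simp
  next
    case False
    then show ?thesis using per_nat[OF that, of "\<theta> + of_int k" "nat (- k)"] by simp
  qed
  have "compact ((\<lambda>(t, \<theta>). f t \<theta>) ` ({a..b} \<times> {0..1}))"
    by (intro compact_continuous_image continuous_on_subset[OF cont] compact_Times) auto
  then obtain K where "K > 0"
    and "\<forall>y \<in> (\<lambda>(t, \<theta>). f t \<theta>) ` ({a..b} \<times> {0..1}). norm y \<le> K"
    using compact_imp_bounded bounded_pos by metis
  then have K: "K > 0" "\<And>t \<theta>. t \<in> {a..b} \<Longrightarrow> \<theta> \<in> {0..1} \<Longrightarrow> \<bar>f t \<theta>\<bar> \<le> K"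
    by simp_all
  have "\<bar>f t \<theta>\<bar> \<le> K" if "t \<in> {a..b}" for t \<theta>
  proof -
    have "f t \<theta> = f t (frac \<theta>)"
      using per_int[OF that, of "frac \<theta>" "\<lfloor>\<theta>\<rfloor>"] by (simp add: frac_def)
    then show ?thesis
      using K(2)[OF that, of "frac \<theta>"] frac_lt_1[of \<theta>] by (simp add: less_imp_le)
  qed
  then show ?thesis using K(1) by blast
qed

text \<open>
  Continuity in \<open>\<theta>\<close> at a single time spreads to joint continuity, because the bound on the time
  derivative makes the function Lipschitz in time with a constant that does not depend on \<open>\<theta>\<close>.
\<close>

lemma continuous_on_time_strip:
  fixes P p :: "real \<Rightarrow> real \<Rightarrow> real"
  assumes Pt: "\<And>t \<theta>. t \<in> {a..b} \<Longrightarrow> ((\<lambda>s. P s \<theta>) has_real_derivative p t \<theta>) (at t within {a..b})"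
    and bound: "\<And>t \<theta>. t \<in> {a..b} \<Longrightarrow> \<bar>p t \<theta>\<bar> \<le> K"
    and cont: "\<And>t. t \<in> {a..b} \<Longrightarrow> continuous_on UNIV (P t)"
  shows "continuous_on ({a..b} \<times> UNIV) (\<lambda>(t, \<theta>). P t \<theta>)"
  unfolding continuous_on_def
proof
  fix z assume "z \<in> {a..b} \<times> (UNIV :: real set)"
  then obtain t0 \<theta>0 where z: "z = (t0, \<theta>0)" and t0: "t0 \<in> {a..b}" by auto
  let ?F = "at (t0, \<theta>0) within {a..b} \<times> UNIV"
  have lip: "\<bar>P t \<theta> - P t0 \<theta>\<bar> \<le> K * \<bar>t - t0\<bar>" if "t \<in> {a..b}" for t \<theta>
    using field_differentiable_bound[of "{a..b}" "\<lambda>s. P s \<theta>" "\<lambda>s. p s \<theta>" K t t0] Pt bound that t0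
    by simp
  have snd_lim: "(snd \<longlongrightarrow> \<theta>0) ?F" and fst_lim: "(fst \<longlongrightarrow> t0) ?F"
    using tendsto_snd[OF tendsto_ident_at] tendsto_fst[OF tendsto_ident_at] by force+
  have "isCont (P t0) \<theta>0"
    using cont[OF t0] by (simp add: continuous_on_eq_continuous_at)
  then have "((\<lambda>z. P t0 (snd z)) \<longlongrightarrow> P t0 \<theta>0) ?F"
    by (rule isCont_tendsto_compose[OF _ snd_lim])
  moreover have "((\<lambda>z. P (fst z) (snd z) - P t0 (snd z)) \<longlongrightarrow> 0) ?F"
  proof (rule Lim_null_comparison)
    show "\<forall>\<^sub>F z in ?F. norm (P (fst z) (snd z) - P t0 (snd z)) \<le> K * \<bar>fst z - t0\<bar>"
      unfolding eventually_at_filter by (rule always_eventually) (auto intro: lip)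
    have "((\<lambda>z. K * \<bar>fst z - t0\<bar>) \<longlongrightarrow> K * \<bar>t0 - t0\<bar>) ?F"
      by (intro tendsto_intros fst_lim)
    then show "((\<lambda>z. K * \<bar>fst z - t0\<bar>) \<longlongrightarrow> 0) ?F" by simp
  qed
  ultimately have "((\<lambda>z. P (fst z) (snd z) - P t0 (snd z) + P t0 (snd z)) \<longlongrightarrow> 0 + P t0 \<theta>0) ?F"
    by (intro tendsto_add)
  then show "((\<lambda>(t, \<theta>). P t \<theta>) \<longlongrightarrow> (case z of (t, \<theta>) \<Rightarrow> P t \<theta>)) (at z within {a..b} \<times> UNIV)"
    by (simp add: case_prod_unfold z)
qed

text \<open>
  Differentiating \<open>P s \<theta> = P a \<theta> + integral {a..s} (\<lambda>\<tau>. p \<tau> \<theta>)\<close> in \<open>\<theta>\<close> under the integral sign.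
  The existence of \<open>\<partial>\<^sub>\<theta> P\<close> at every time is assumed, but its differentiability in time comes for
  free; this is what makes the lemma usable where \<open>\<partial>\<^sub>\<theta> P\<close> is known to be no better than continuous.
\<close>

lemma has_real_derivative_swap:
  fixes P p q R :: "real \<Rightarrow> real \<Rightarrow> real"
  assumes Pt: "\<And>t \<theta>. t \<in> {a..b} \<Longrightarrow> ((\<lambda>s. P s \<theta>) has_real_derivative p t \<theta>) (at t within {a..b})"
    and Ptheta: "\<And>t \<theta>. t \<in> {a..b} \<Longrightarrow> (P t has_real_derivative R t \<theta>) (at \<theta>)"
    and ptheta: "\<And>t \<theta>. t \<in> {a..b} \<Longrightarrow> (p t has_real_derivative q t \<theta>) (at \<theta>)"
    and cont: "continuous_on ({a..b} \<times> UNIV) (\<lambda>(t, \<theta>). q t \<theta>)"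
    and t: "t \<in> {a..b}"
  shows "((\<lambda>s. R s \<theta>) has_real_derivative q t \<theta>) (at t within {a..b})"
proof -
  have int: "((\<lambda>\<tau>. p \<tau> \<theta>') has_integral (P s \<theta>' - P a \<theta>')) {a..s}" if "s \<in> {a..b}" for s \<theta>'
  proof (rule fundamental_theorem_of_calculus)
    fix r assume "r \<in> {a..s}"
    then have "((\<lambda>s. P s \<theta>') has_real_derivative p r \<theta>') (at r within {a..s})"
      using that by (intro DERIV_subset[OF Pt]) auto
    then show "((\<lambda>s. P s \<theta>') has_vector_derivative p r \<theta>') (at r within {a..s})"
      by (simp add: has_real_derivative_iff_has_vector_derivative)
  qed (use that in auto)
  have R: "R s \<theta> = R a \<theta> + integral {a..s} (\<lambda>\<tau>. q \<tau> \<theta>)" if s: "s \<in> {a..b}" for s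
  proof -
    have "((\<lambda>\<theta>'. integral (cbox a s) (\<lambda>\<tau>. p \<tau> \<theta>'))
        has_real_derivative integral (cbox a s) (\<lambda>\<tau>. q \<tau> \<theta>)) (at \<theta> within UNIV)"
    proof (rule leibniz_rule_field_derivative)
      show "(\<lambda>\<tau>. p \<tau> \<theta>') integrable_on cbox a s" for \<theta>'
        using int[OF s, of \<theta>'] by (auto simp: integrable_on_def)
      show "continuous_on (UNIV \<times> cbox a s) (\<lambda>(\<theta>', \<tau>). q \<tau> \<theta>')"
      proof -
        have "prod.swap ` (UNIV \<times> {a..s}) \<subseteq> {a..b} \<times> UNIV" using s by auto
        from continuous_on_compose2[OF cont continuous_on_swap this] show ?thesis
          by (simp add: case_prod_beta)
      qed
    qed (use s ptheta in auto)
    then have "((\<lambda>\<theta>'. P s \<theta>' - P a \<theta>') has_real_derivative integral {a..s} (\<lambda>\<tau>. q \<tau> \<theta>)) (at \<theta>)"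
      using integral_unique[OF int[OF s]] by simp
    moreover have "((\<lambda>\<theta>'. P s \<theta>' - P a \<theta>') has_real_derivative R s \<theta> - R a \<theta>) (at \<theta>)"
      using s by (intro DERIV_diff Ptheta) auto
    ultimately show ?thesis using DERIV_unique by fastforce
  qed
  have "continuous_on {a..b} (\<lambda>\<tau>. q \<tau> \<theta>)"
    using continuous_on_compose2[OF cont, of "{a..b}" "\<lambda>\<tau>. (\<tau>, \<theta>)"]
    by (simp add: continuous_on_Pair image_subset_iff)
  then have "((\<lambda>s. R a \<theta> + integral {a..s} (\<lambda>\<tau>. q \<tau> \<theta>)) has_real_derivative 0 + q t \<theta>)
      (at t within {a..b})"
    by (intro DERIV_add DERIV_const integral_has_real_derivative t)
  then have "((\<lambda>s. R a \<theta> + integral {a..s} (\<lambda>\<tau>. q \<tau> \<theta>)) has_real_derivative q t \<theta>)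
      (at t within {a..b})" by simp
  then show ?thesis
    by (rule has_field_derivative_transform_within[OF _ zero_less_one t]) (rule R[symmetric])
qed

text \<open>
  One partial derivative may be merely pointwise if the other one is continuous: this is enough for
  total differentiability, hence for the chain rule.
\<close>

lemma has_real_derivative_along_curve:
  fixes f ft fth :: "real \<Rightarrow> real \<Rightarrow> real"
  assumes ft: "\<And>\<theta>. ((\<lambda>s. f s \<theta>) has_real_derivative ft t \<theta>) (at t within J)"
    and fth: "\<And>s \<theta>. s \<in> J \<Longrightarrow> (f s has_real_derivative fth s \<theta>) (at \<theta>)"
    and cont: "continuous_on (J \<times> UNIV) (\<lambda>(s, \<theta>). fth s \<theta>)"
    and g: "(g has_real_derivative g') (at t within J)" and t: "t \<in> J"
  shows "((\<lambda>s. f s (g s)) has_real_derivative ft t (g t) + fth t (g t) * g') (at t within J)"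
proof -
  have cont': "continuous (at (t, g t) within J \<times> UNIV)
      (\<lambda>(s, \<theta>). blinfun_scaleR_left (fth s \<theta>) :: real \<Rightarrow>\<^sub>L real)"
    using bounded_linear.continuous_on[OF bounded_linear_blinfun_scaleR_left cont] t
    unfolding continuous_on_eq_continuous_within by (auto simp: case_prod_unfold)
  have "((\<lambda>(s, \<theta>). f s \<theta>) has_derivative
      (\<lambda>(ds, d\<theta>). ft t (g t) * ds + blinfun_apply (blinfun_scaleR_left (fth t (g t))) d\<theta>))
      (at (t, g t) within J \<times> UNIV)"
    using ft fth cont'
    by (intro has_derivative_partialsI)
      (auto simp: has_field_derivative_def mult.commute[of _ "fth _ _"])
  then have D: "((\<lambda>(s, \<theta>). f s \<theta>) has_derivative
      (\<lambda>(ds, d\<theta>). ft t (g t) * ds + blinfun_apply (blinfun_scaleR_left (fth t (g t))) d\<theta>))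
      (at (t, g t) within (\<lambda>s. (s, g s)) ` J)"
    by (rule has_derivative_subset) auto
  have "((\<lambda>s. (s, g s)) has_derivative (\<lambda>h. (h, g' * h))) (at t within J)"
    using g unfolding has_field_derivative_def by (intro has_derivative_Pair has_derivative_ident)
  from has_derivative_in_compose[OF this D]
  have "((\<lambda>s. f s (g s)) has_derivative (\<lambda>h. ft t (g t) * h + (g' * h) * fth t (g t))) (at t within J)"
    by simp
  then show ?thesis
    unfolding has_field_derivative_def by (rule has_derivative_eq_rhs) (auto simp: algebra_simps)
qed

section \<open>The flow over a compact time interval\<close>

text \<open>
  The names ending in \<open>1\<close> and \<open>2\<close> are first and second space derivatives.  The time interval is
  compact in order to have uniform bounds.  The term \<open>I\<close>, which contains the energy, depends on time
  only: it disappears when the equation is differentiated in space.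
\<close>

locale smooth_circle_flow =
  fixes a b lam \<sigma> :: real and I :: "real \<Rightarrow> real" and u u1 u2 \<eta> \<eta>1 \<eta>2 :: "real \<Rightarrow> real \<Rightarrow> real"
  assumes per: "t \<in> {a..b} \<Longrightarrow> u t (\<theta> + 1) = u t \<theta>"
    and u_th: "t \<in> {a..b} \<Longrightarrow> (u t has_real_derivative u1 t \<theta>) (at \<theta>)"
    and u1_th: "t \<in> {a..b} \<Longrightarrow> (u1 t has_real_derivative u2 t \<theta>) (at \<theta>)"
    and cont_u: "continuous_on ({a..b} \<times> UNIV) (\<lambda>(t, \<theta>). u t \<theta>)"
    and cont_u1: "continuous_on ({a..b} \<times> UNIV) (\<lambda>(t, \<theta>). u1 t \<theta>)"
    and cont_u2: "continuous_on ({a..b} \<times> UNIV) (\<lambda>(t, \<theta>). u2 t \<theta>)"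
    and u1_t: "t \<in> {a..b} \<Longrightarrow> ((\<lambda>s. u1 s \<theta>) has_real_derivative
        I t + lam * \<sigma> * u t \<theta> - (lam - 1) / 2 * (u1 t \<theta>)\<^sup>2 - u t \<theta> * u2 t \<theta>) (at t within {a..b})"
    and eta_t: "t \<in> {a..b} \<Longrightarrow> ((\<lambda>s. \<eta> s \<theta>) has_real_derivative u t (\<eta> t \<theta>)) (at t within {a..b})"
    and eta_th: "t \<in> {a..b} \<Longrightarrow> (\<eta> t has_real_derivative \<eta>1 t \<theta>) (at \<theta>)"
    and eta1_th: "t \<in> {a..b} \<Longrightarrow> (\<eta>1 t has_real_derivative \<eta>2 t \<theta>) (at \<theta>)"
    and eta1_pos: "t \<in> {a..b} \<Longrightarrow> \<eta>1 t \<theta> > 0"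
begin

lemma u1_per:
  assumes "t \<in> {a..b}"
  shows "u1 t (\<theta> + 1) = u1 t \<theta>"
proof -
  have "((\<lambda>\<theta>. u t (\<theta> + 1)) has_real_derivative u1 t (\<theta> + 1)) (at \<theta>)"
    using u_th[OF assms, of "\<theta> + 1"] by (simp add: DERIV_shift)
  then show ?thesis
    using u_th[OF assms, of \<theta>] per[OF assms] by (simp add: DERIV_unique)
qed

lemma u2_per:
  assumes "t \<in> {a..b}"
  shows "u2 t (\<theta> + 1) = u2 t \<theta>"
proof -
  have "((\<lambda>\<theta>. u1 t (\<theta> + 1)) has_real_derivative u2 t (\<theta> + 1)) (at \<theta>)"
    using u1_th[OF assms, of "\<theta> + 1"] by (simp add: DERIV_shift)
  then show ?thesis
    using u1_th[OF assms, of \<theta>] u1_per[OF assms] by (simp add: DERIV_unique)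
qed

lemma u_bounded: "\<exists>K>0. \<forall>t\<in>{a..b}. \<forall>\<theta>. \<bar>u t \<theta>\<bar> \<le> K"
  by (rule bounded_time_strip[OF cont_u]) (rule per)

lemma u1_bounded: "\<exists>K>0. \<forall>t\<in>{a..b}. \<forall>\<theta>. \<bar>u1 t \<theta>\<bar> \<le> K"
  by (rule bounded_time_strip[OF cont_u1]) (rule u1_per)

lemma u2_bounded: "\<exists>K>0. \<forall>t\<in>{a..b}. \<forall>\<theta>. \<bar>u2 t \<theta>\<bar> \<le> K"
  by (rule bounded_time_strip[OF cont_u2]) (rule u2_per)

lemma cont_eta: "continuous_on ({a..b} \<times> UNIV) (\<lambda>(t, \<theta>). \<eta> t \<theta>)"
proof -
  obtain K where "\<And>t \<theta>. t \<in> {a..b} \<Longrightarrow> \<bar>u t \<theta>\<bar> \<le> K"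
    using u_bounded by blast
  then have "\<And>t \<theta>. t \<in> {a..b} \<Longrightarrow> \<bar>u t (\<eta> t \<theta>)\<bar> \<le> K" by blast
  moreover have "continuous_on UNIV (\<eta> t)" if "t \<in> {a..b}" for t
    using DERIV_isCont[OF eta_th[OF that]] by (simp add: continuous_on_eq_continuous_at)
  ultimately show ?thesis
    using eta_t by (intro continuous_on_time_strip[where p="\<lambda>t \<theta>. u t (\<eta> t \<theta>)" and K=K]) blast+
qed

lemma cont_along:
  assumes "continuous_on ({a..b} \<times> UNIV) (\<lambda>(t, \<theta>). f t \<theta> :: real)"
  shows "continuous_on ({a..b} \<times> UNIV) (\<lambda>(t, \<theta>). f t (\<eta> t \<theta>))"
proof -
  have "continuous_on ({a..b} \<times> UNIV) (\<lambda>z. (fst z, \<eta> (fst z) (snd z)))"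
    using cont_eta by (intro continuous_intros) (simp add: case_prod_unfold)
  from continuous_on_compose2[OF assms this] show ?thesis
    by (simp add: case_prod_unfold image_subset_iff)
qed

text \<open>
  The variational equation of the flow, in logarithmic form.  It cannot come from
  \<open>has_real_derivative_swap\<close>, as joint continuity of \<open>\<eta>1\<close> is only a consequence of it.  Instead,
  compare two nearby trajectories: their distance \<open>D\<close> satisfies \<open>(ln D)' = A\<close> with \<open>A\<close> a value of
  \<open>u1\<close> between them.  Boundedness of \<open>u1\<close> keeps \<open>D\<close> comparable to its value at time \<open>a\<close>, and
  boundedness of \<open>u2\<close> then makes \<open>A\<close> close to \<open>u1\<close> along the trajectory, uniformly in time.
\<close>

lemma ln_eta1_t:
  assumes t: "t \<in> {a..b}"
  shows "((\<lambda>s. ln (\<eta>1 s \<theta>)) has_real_derivative u1 t (\<eta> t \<theta>)) (at t within {a..b})"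
proof -
  obtain K where K: "K > 0" "\<And>t \<theta>. t \<in> {a..b} \<Longrightarrow> \<bar>u1 t \<theta>\<bar> \<le> K"
    using u1_bounded by blast
  obtain M where M: "M > 0" "\<And>t \<theta>. t \<in> {a..b} \<Longrightarrow> \<bar>u2 t \<theta>\<bar> \<le> M"
    using u2_bounded by blast
  define g where "g s = integral {a..s} (\<lambda>\<tau>. u1 \<tau> (\<eta> \<tau> \<theta>))" for s
  have "continuous_on {a..b} (\<lambda>\<tau>. u1 \<tau> (\<eta> \<tau> \<theta>))"
    using continuous_on_compose2[OF cont_along[OF cont_u1], of "{a..b}" "\<lambda>\<tau>. (\<tau>, \<theta>)"]
    by (simp add: continuous_on_Pair image_subset_iff)
  then have g: "(g has_real_derivative u1 s (\<eta> s \<theta>)) (at s within {a..b})" if "s \<in> {a..b}" for s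
    unfolding g_def using that by (rule integral_has_real_derivative)
  define D where "D s \<theta>' = \<eta> s \<theta>' - \<eta> s \<theta>" for s \<theta>'
  \<comment> \<open>\<open>D\<close> grows at most by the exponential factor, \<open>A\<close> is off by at most \<open>M * D\<close>, for a time \<open>b - a\<close>.\<close>
  define C where "C = M * exp (K * (b - a)) * (b - a)"
  have ab: "a \<in> {a..b}" "a \<le> b" using t by auto
  have D_pos: "D s \<theta>' > 0" if "s \<in> {a..b}" "\<theta>' > \<theta>" for s \<theta>'
    unfolding D_def using DERIV_pos_imp_increasing[of \<theta> \<theta>' "\<eta> s"] that eta_th eta1_pos by fastforce
  \<comment> \<open>The initial distance \<open>D a \<theta>'\<close> tends to \<open>0\<close> as \<open>\<theta>'\<close> decreases to \<open>\<theta>\<close>.\<close>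
  have est: "\<bar>(ln (D s \<theta>') - ln (D a \<theta>')) - (g s - g a)\<bar> \<le> C * D a \<theta>'"
    if s: "s \<in> {a..b}" and \<theta>': "\<theta>' > \<theta>" for s \<theta>'
  proof -
    define A where "A r = (u r (\<eta> r \<theta>') - u r (\<eta> r \<theta>)) / D r \<theta>'" for r
    have A: "\<exists>\<xi>. \<eta> r \<theta> < \<xi> \<and> \<xi> < \<eta> r \<theta>' \<and> A r = u1 r \<xi>" if r: "r \<in> {a..b}" for r
    proof -
      have "\<eta> r \<theta> < \<eta> r \<theta>'" using D_pos[OF r \<theta>'] by (simp add: D_def)
      from MVT2[OF this u_th[OF r]] obtain \<xi> where "\<eta> r \<theta> < \<xi>" "\<xi> < \<eta> r \<theta>'"
        "u r (\<eta> r \<theta>') - u r (\<eta> r \<theta>) = D r \<theta>' * u1 r \<xi>" by (auto simp: D_def)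
      then show ?thesis using D_pos[OF r \<theta>'] by (auto simp: A_def)
    qed
    have lnD: "((\<lambda>r. ln (D r \<theta>')) has_real_derivative A r) (at r within {a..b})"
      if r: "r \<in> {a..b}" for r
      using D_pos[OF r \<theta>'] unfolding D_def A_def
      by (auto intro!: derivative_eq_intros eta_t[OF r])
    have growth: "D r \<theta>' \<le> exp (K * (b - a)) * D a \<theta>'" if r: "r \<in> {a..b}" for r
    proof -
      have "norm (ln (D r \<theta>') - ln (D a \<theta>')) \<le> K * norm (r - a)"
        using A K(2) by (intro field_differentiable_bound[OF _ lnD] r ab) fastforce+
      also have "\<dots> \<le> K * (b - a)" using r K(1) by (simp add: mult_left_mono)
      finally have "ln (D r \<theta>') \<le> K * (b - a) + ln (D a \<theta>')" by simp
      then have "exp (ln (D r \<theta>')) \<le> exp (K * (b - a) + ln (D a \<theta>'))" by simp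
      then show ?thesis using D_pos r ab \<theta>' by (simp add: exp_add)
    qed
    have diff: "\<bar>A r - u1 r (\<eta> r \<theta>)\<bar> \<le> M * (exp (K * (b - a)) * D a \<theta>')" if r: "r \<in> {a..b}" for r
    proof -
      obtain \<xi> where \<xi>: "\<eta> r \<theta> < \<xi>" "\<xi> < \<eta> r \<theta>'" "A r = u1 r \<xi>" using A[OF r] by blast
      have "norm (u1 r \<xi> - u1 r (\<eta> r \<theta>)) \<le> M * norm (\<xi> - \<eta> r \<theta>)"
        by (rule field_differentiable_bound[of UNIV]) (use u1_th[OF r] M(2)[OF r] in auto)
      also have "\<dots> \<le> M * D r \<theta>'" using \<xi> M(1) by (simp add: D_def)
      also have "\<dots> \<le> M * (exp (K * (b - a)) * D a \<theta>')" using growth[OF r] M(1) by simp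
      finally show ?thesis using \<xi>(3) by simp
    qed
    have "norm ((ln (D s \<theta>') - g s) - (ln (D a \<theta>') - g a))
        \<le> M * (exp (K * (b - a)) * D a \<theta>') * norm (s - a)"
      by (rule field_differentiable_bound[of "{a..b}" _ "\<lambda>r. A r - u1 r (\<eta> r \<theta>)"])
        (use s ab diff in \<open>auto intro!: DERIV_diff lnD g\<close>)
    also have "\<dots> \<le> M * (exp (K * (b - a)) * D a \<theta>') * (b - a)"
      using s ab M(1) D_pos[OF ab(1) \<theta>'] by (intro mult_left_mono) auto
    finally show ?thesis by (simp add: C_def algebra_simps)
  qed
  have lim: "((\<lambda>\<theta>'. ln (D s \<theta>' / (\<theta>' - \<theta>))) \<longlongrightarrow> ln (\<eta>1 s \<theta>)) (at_right \<theta>)" if s: "s \<in> {a..b}" for s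
  proof -
    have "(\<eta> s has_real_derivative \<eta>1 s \<theta>) (at_right \<theta>)"
      using eta_th[OF s] by (rule has_field_derivative_at_within)
    then have "((\<lambda>\<theta>'. D s \<theta>' / (\<theta>' - \<theta>)) \<longlongrightarrow> \<eta>1 s \<theta>) (at_right \<theta>)"
      by (simp add: has_field_derivative_iff D_def)
    then show ?thesis using eta1_pos[OF s, of \<theta>] by (intro tendsto_ln) auto
  qed
  \<comment> \<open>The factors \<open>\<theta>' - \<theta>\<close> cancel in \<open>?h\<close>, so the estimate applies to difference quotients.\<close>
  have formula: "ln (\<eta>1 s \<theta>) = ln (\<eta>1 a \<theta>) - g a + g s" if s: "s \<in> {a..b}" for s
  proof -
    let ?h = "\<lambda>\<theta>'. ln (D s \<theta>' / (\<theta>' - \<theta>)) - ln (D a \<theta>' / (\<theta>' - \<theta>)) - (g s - g a)"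
    have "(?h \<longlongrightarrow> ln (\<eta>1 s \<theta>) - ln (\<eta>1 a \<theta>) - (g s - g a)) (at_right \<theta>)"
      by (intro tendsto_diff lim s ab tendsto_const)
    moreover have "(?h \<longlongrightarrow> 0) (at_right \<theta>)"
    proof (rule Lim_null_comparison)
      show "\<forall>\<^sub>F \<theta>' in at_right \<theta>. norm (?h \<theta>') \<le> C * D a \<theta>'"
        unfolding eventually_at_filter
      proof (intro always_eventually allI impI)
        fix \<theta>' assume "\<theta>' \<in> {\<theta><..}"
        then have "\<theta>' > \<theta>" by simp
        then show "norm (?h \<theta>') \<le> C * D a \<theta>'"
          using est[OF s \<open>\<theta>' > \<theta>\<close>] D_pos[OF s \<open>\<theta>' > \<theta>\<close>] D_pos[OF ab(1) \<open>\<theta>' > \<theta>\<close>]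
          by (simp add: ln_div)
      qed
      have "isCont (\<eta> a) \<theta>" using eta_th[OF ab(1)] by (rule DERIV_isCont)
      then have "(\<eta> a \<longlongrightarrow> \<eta> a \<theta>) (at_right \<theta>)"
        by (simp add: continuous_at filterlim_at_split)
      then have "((\<lambda>\<theta>'. C * D a \<theta>') \<longlongrightarrow> C * (\<eta> a \<theta> - \<eta> a \<theta>)) (at_right \<theta>)"
        unfolding D_def by (intro tendsto_intros)
      then show "((\<lambda>\<theta>'. C * D a \<theta>') \<longlongrightarrow> 0) (at_right \<theta>)" by simp
    qed
    ultimately have "ln (\<eta>1 s \<theta>) - ln (\<eta>1 a \<theta>) - (g s - g a) = 0"
      using tendsto_unique trivial_limit_at_right_real by blast
    then show ?thesis by simp
  qed
  have "((\<lambda>s. ln (\<eta>1 a \<theta>) - g a + g s) has_real_derivative u1 t (\<eta> t \<theta>)) (at t within {a..b})"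
    using g[OF t] by (auto intro!: derivative_eq_intros)
  then show ?thesis
    by (rule has_field_derivative_transform_within[OF _ zero_less_one t]) (rule formula[symmetric])
qed

lemma eta1_t:
  assumes t: "t \<in> {a..b}"
  shows "((\<lambda>s. \<eta>1 s \<theta>) has_real_derivative u1 t (\<eta> t \<theta>) * \<eta>1 t \<theta>) (at t within {a..b})"
proof -
  have "((\<lambda>s. exp (ln (\<eta>1 s \<theta>))) has_real_derivative u1 t (\<eta> t \<theta>) * \<eta>1 t \<theta>) (at t within {a..b})"
    using DERIV_chain2[OF DERIV_exp ln_eta1_t[OF t, of \<theta>]] eta1_pos[OF t, of \<theta>]
    by (simp add: mult.commute)
  then show ?thesis
    by (rule has_field_derivative_transform_within[OF _ zero_less_one t]) (simp add: eta1_pos)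
qed

lemma cont_eta1: "continuous_on ({a..b} \<times> UNIV) (\<lambda>(t, \<theta>). \<eta>1 t \<theta>)"
proof -
  obtain K where "\<And>t \<theta>. t \<in> {a..b} \<Longrightarrow> \<bar>u1 t \<theta>\<bar> \<le> K"
    using u1_bounded by blast
  then have "\<And>t \<theta>. t \<in> {a..b} \<Longrightarrow> \<bar>u1 t (\<eta> t \<theta>)\<bar> \<le> K" by blast
  moreover have "continuous_on UNIV (\<lambda>\<theta>. ln (\<eta>1 t \<theta>))" if "t \<in> {a..b}" for t
  proof (rule continuous_on_ln)
    show "continuous_on UNIV (\<eta>1 t)"
      using DERIV_isCont[OF eta1_th[OF that]] by (simp add: continuous_on_eq_continuous_at)
    show "\<forall>\<theta>\<in>UNIV. \<eta>1 t \<theta> \<noteq> 0"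
      using eta1_pos[OF that] by (metis less_irrefl)
  qed
  ultimately have "continuous_on ({a..b} \<times> UNIV) (\<lambda>(t, \<theta>). ln (\<eta>1 t \<theta>))"
    using ln_eta1_t by (intro continuous_on_time_strip[where p="\<lambda>t \<theta>. u1 t (\<eta> t \<theta>)" and K=K]) blast+
  then have "continuous_on ({a..b} \<times> UNIV) (\<lambda>z. exp (ln (\<eta>1 (fst z) (snd z))))"
    by (intro continuous_on_exp) (simp add: case_prod_unfold)
  then show ?thesis
    by (rule continuous_on_eq) (auto simp: eta1_pos)
qed

lemma cont_u2_eta1: "continuous_on ({a..b} \<times> UNIV) (\<lambda>(t, \<theta>). u2 t (\<eta> t \<theta>) * \<eta>1 t \<theta>)"
  using continuous_on_mult[OF cont_along[OF cont_u2] cont_eta1] by (simp add: case_prod_unfold)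

lemma u_along_th:
  assumes "t \<in> {a..b}"
  shows "((\<lambda>\<theta>. u t (\<eta> t \<theta>)) has_real_derivative u1 t (\<eta> t \<theta>) * \<eta>1 t \<theta>) (at \<theta>)"
  by (rule DERIV_chain2[OF u_th eta_th]) (use assms in auto)

lemma u1_along_th:
  assumes "t \<in> {a..b}"
  shows "((\<lambda>\<theta>. u1 t (\<eta> t \<theta>)) has_real_derivative u2 t (\<eta> t \<theta>) * \<eta>1 t \<theta>) (at \<theta>)"
  by (rule DERIV_chain2[OF u1_th eta_th]) (use assms in auto)

text \<open>The quotient is the space derivative of \<open>ln \<eta>\<^sub>\<theta>\<close>.\<close>

lemma eta2_over_eta1_t:
  assumes t: "t \<in> {a..b}"
  shows "((\<lambda>s. \<eta>2 s \<theta> / \<eta>1 s \<theta>) has_real_derivative u2 t (\<eta> t \<theta>) * \<eta>1 t \<theta>) (at t within {a..b})"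
proof (rule has_real_derivative_swap[where P="\<lambda>s \<theta>. ln (\<eta>1 s \<theta>)" and p="\<lambda>s \<theta>. u1 s (\<eta> s \<theta>)"
      and R="\<lambda>s \<theta>. \<eta>2 s \<theta> / \<eta>1 s \<theta>" and q="\<lambda>s \<theta>. u2 s (\<eta> s \<theta>) * \<eta>1 s \<theta>"])
  show "((\<lambda>\<theta>. ln (\<eta>1 s \<theta>)) has_real_derivative \<eta>2 s \<theta> / \<eta>1 s \<theta>) (at \<theta>)"
    if s: "s \<in> {a..b}" for s \<theta>
    using eta1_pos[OF s, of \<theta>] by (auto intro!: derivative_eq_intros eta1_th[OF s])
qed (use ln_eta1_t u1_along_th cont_u2_eta1 t in blast)+

text \<open>
  The transport term \<open>u u\<^sub>\<theta>\<^sub>\<theta>\<close> of the equation is the contribution of the moving point to the time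
  derivative, so a Riccati equation without second derivatives remains.
\<close>

lemma u1_along_t:
  assumes t: "t \<in> {a..b}"
  shows "((\<lambda>s. u1 s (\<eta> s \<theta>)) has_real_derivative
    I t + lam * \<sigma> * u t (\<eta> t \<theta>) - (lam - 1) / 2 * (u1 t (\<eta> t \<theta>))\<^sup>2) (at t within {a..b})"
  using has_real_derivative_along_curve[where f=u1 and fth=u2 and t=t and J="{a..b}"
      and ft="\<lambda>t \<theta>. I t + lam * \<sigma> * u t \<theta> - (lam - 1) / 2 * (u1 t \<theta>)\<^sup>2 - u t \<theta> * u2 t \<theta>",
      OF u1_t[OF t] u1_th cont_u2 eta_t[OF t] t]
  by (simp add: mult.commute)

text \<open>
  The space derivative of the Riccati equation.  It plays the role of the equation for \<open>m\<close>, which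
  would contain a derivative of \<open>u\<^sub>\<theta>\<^sub>\<theta>\<close>.
\<close>

lemma u2_eta1_t:
  assumes t: "t \<in> {a..b}"
  shows "((\<lambda>s. u2 s (\<eta> s \<theta>) * \<eta>1 s \<theta>) has_real_derivative
    lam * \<sigma> * (u1 t (\<eta> t \<theta>) * \<eta>1 t \<theta>)
      - (lam - 1) * (u1 t (\<eta> t \<theta>) * (u2 t (\<eta> t \<theta>) * \<eta>1 t \<theta>))) (at t within {a..b})"
proof (rule has_real_derivative_swap[where P="\<lambda>s \<theta>. u1 s (\<eta> s \<theta>)"
      and p="\<lambda>s \<theta>. I s + lam * \<sigma> * u s (\<eta> s \<theta>) - (lam - 1) / 2 * (u1 s (\<eta> s \<theta>))\<^sup>2"
      and R="\<lambda>s \<theta>. u2 s (\<eta> s \<theta>) * \<eta>1 s \<theta>"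
      and q="\<lambda>s \<theta>. lam * \<sigma> * (u1 s (\<eta> s \<theta>) * \<eta>1 s \<theta>)
        - (lam - 1) * (u1 s (\<eta> s \<theta>) * (u2 s (\<eta> s \<theta>) * \<eta>1 s \<theta>))"])
  show "((\<lambda>\<theta>. I s + lam * \<sigma> * u s (\<eta> s \<theta>) - (lam - 1) / 2 * (u1 s (\<eta> s \<theta>))\<^sup>2) has_real_derivative
      lam * \<sigma> * (u1 s (\<eta> s \<theta>) * \<eta>1 s \<theta>)
        - (lam - 1) * (u1 s (\<eta> s \<theta>) * (u2 s (\<eta> s \<theta>) * \<eta>1 s \<theta>))) (at \<theta>)"
    if s: "s \<in> {a..b}" for s \<theta>
    by (auto intro!: derivative_eq_intros u_along_th[OF s] u1_along_th[OF s])
  show "continuous_on ({a..b} \<times> UNIV) (\<lambda>(t, \<theta>). lam * \<sigma> * (u1 t (\<eta> t \<theta>) * \<eta>1 t \<theta>)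
        - (lam - 1) * (u1 t (\<eta> t \<theta>) * (u2 t (\<eta> t \<theta>) * \<eta>1 t \<theta>)))"
    using cont_along[OF cont_u1] cont_along[OF cont_u2] cont_eta1 unfolding case_prod_unfold
    by (intro continuous_on_diff continuous_on_mult continuous_on_const)
qed (use u1_along_t u1_along_th t in blast)+

lemma eta1_powr_t:
  assumes t: "t \<in> {a..b}"
  shows "((\<lambda>s. \<eta>1 s \<theta> powr c) has_real_derivative c * u1 t (\<eta> t \<theta>) * \<eta>1 t \<theta> powr c) (at t within {a..b})"
proof -
  have "\<eta>1 t \<theta> powr (c - 1) * \<eta>1 t \<theta> = \<eta>1 t \<theta> powr c"
    using eta1_pos[OF t, of \<theta>] by (simp add: powr_diff)
  then have "c * \<eta>1 t \<theta> powr (c - 1) * (u1 t (\<eta> t \<theta>) * \<eta>1 t \<theta>) = c * u1 t (\<eta> t \<theta>) * \<eta>1 t \<theta> powr c"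
    by (simp add: mult_ac)
  moreover have "((\<lambda>s. \<eta>1 s \<theta> powr c) has_real_derivative
      c * \<eta>1 t \<theta> powr (c - 1) * (u1 t (\<eta> t \<theta>) * \<eta>1 t \<theta>)) (at t within {a..b})"
    by (rule DERIV_chain2[OF has_real_derivative_powr[OF eta1_pos[OF t]] eta1_t[OF t]])
  ultimately show ?thesis by (simp only:)
qed

text \<open>
  The factor \<open>\<eta>\<^sub>\<theta> powr (\<lambda> - 1)\<close> is an integrating factor for the damping term
  \<open>- (\<lambda> - 1) v w\<close> in the equation of \<open>w = u\<^sub>\<theta>\<^sub>\<theta>(t, \<eta>) \<eta>\<^sub>\<theta>\<close>.
\<close>

lemma transported_momentum_constant:
  assumes s: "s \<in> {a..b}" and t: "t \<in> {a..b}"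
  shows "\<eta>1 s \<theta> powr lam * (\<sigma> - u2 s (\<eta> s \<theta>)) = \<eta>1 t \<theta> powr lam * (\<sigma> - u2 t (\<eta> t \<theta>))"
proof -
  define N where "N s = \<eta>1 s \<theta> powr (lam - 1) * (\<sigma> * \<eta>1 s \<theta> - u2 s (\<eta> s \<theta>) * \<eta>1 s \<theta>)" for s
  have N: "N s = \<eta>1 s \<theta> powr lam * (\<sigma> - u2 s (\<eta> s \<theta>))" if "s \<in> {a..b}" for s
  proof -
    have "\<eta>1 s \<theta> powr (lam - 1) * \<eta>1 s \<theta> = \<eta>1 s \<theta> powr lam"
      using eta1_pos[OF that, of \<theta>] by (simp add: powr_diff)
    moreover have "N s = (\<eta>1 s \<theta> powr (lam - 1) * \<eta>1 s \<theta>) * (\<sigma> - u2 s (\<eta> s \<theta>))"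
      by (simp add: N_def algebra_simps)
    ultimately show ?thesis by simp
  qed
  have "(N has_real_derivative 0) (at r within {a..b})" if r: "r \<in> {a..b}" for r
    unfolding N_def
    by (rule DERIV_cong[OF DERIV_mult[OF eta1_powr_t[OF r]
          DERIV_diff[OF DERIV_cmult[OF eta1_t[OF r]] u2_eta1_t[OF r]]]])
      (simp add: algebra_simps)
  then obtain c where "\<forall>s\<in>{a..b}. N s = c"
    using has_field_derivative_zero_constant[of "{a..b}" N] by auto
  then show ?thesis using N s t by metis
qed

text \<open>
  The exponent \<open>(\<lambda> - 1) / 2\<close> is the one that linearises the Riccati equation: the square of
  \<open>c u\<^sub>\<theta>\<close> from differentiating the power cancels the quadratic term.
\<close>

lemma eta1_powr_tt:
  assumes t: "t \<in> {a..b}" and c: "c = (lam - 1) / 2"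
  shows "((\<lambda>s. c * u1 s (\<eta> s \<theta>) * \<eta>1 s \<theta> powr c) has_real_derivative
    c * (I t + lam * \<sigma> * u t (\<eta> t \<theta>)) * \<eta>1 t \<theta> powr c) (at t within {a..b})"
  by (rule DERIV_cong[OF DERIV_mult[OF DERIV_cmult[OF u1_along_t[OF t]] eta1_powr_t[OF t]]])
    (simp add: c[symmetric] algebra_simps power2_eq_square)

text \<open>
  The ansatz \<open>y = x z\<close>, where \<open>Z\<close> is any time integral of \<open>\<eta>\<^sub>\<theta>\<close>; the last summand is \<open>x z\<^sub>t\<close>.
\<close>

lemma second_solution_t:
  assumes t: "t \<in> {a..b}"
    and Z: "(Z has_real_derivative \<eta>1 t \<theta>) (at t within {a..b})"
  shows "((\<lambda>s. \<eta>1 s \<theta> powr c * (\<sigma> * Z s - \<eta>2 s \<theta> / \<eta>1 s \<theta>)) has_real_derivative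
    c * u1 t (\<eta> t \<theta>) * \<eta>1 t \<theta> powr c * (\<sigma> * Z t - \<eta>2 t \<theta> / \<eta>1 t \<theta>)
      + \<eta>1 t \<theta> powr c * (\<sigma> * \<eta>1 t \<theta> - u2 t (\<eta> t \<theta>) * \<eta>1 t \<theta>)) (at t within {a..b})"
  by (rule DERIV_cong[OF DERIV_mult[OF eta1_powr_t[OF t]
        DERIV_diff[OF DERIV_cmult[OF Z] eta2_over_eta1_t[OF t]]]]) simp

text \<open>
  For \<open>y = x z\<close> one has \<open>y\<^sub>t\<^sub>t = x\<^sub>t\<^sub>t z + (2 x\<^sub>t z\<^sub>t + x z\<^sub>t\<^sub>t)\<close>.  The bracket is \<open>(x\<^sup>2 z\<^sub>t)\<^sub>t / x\<close>, which
  vanishes for the same reason as in \<open>transported_momentum_constant\<close>.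
\<close>

lemma second_solution_tt:
  assumes t: "t \<in> {a..b}" and c: "c = (lam - 1) / 2"
    and Z: "(Z has_real_derivative \<eta>1 t \<theta>) (at t within {a..b})"
  shows "((\<lambda>s. c * u1 s (\<eta> s \<theta>) * \<eta>1 s \<theta> powr c * (\<sigma> * Z s - \<eta>2 s \<theta> / \<eta>1 s \<theta>)
        + \<eta>1 s \<theta> powr c * (\<sigma> * \<eta>1 s \<theta> - u2 s (\<eta> s \<theta>) * \<eta>1 s \<theta>)) has_real_derivative
    c * (I t + lam * \<sigma> * u t (\<eta> t \<theta>)) * (\<eta>1 t \<theta> powr c * (\<sigma> * Z t - \<eta>2 t \<theta> / \<eta>1 t \<theta>)))
    (at t within {a..b})"
proof -
  have lam: "lam = 2 * c + 1" using c by simp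
  show ?thesis
    by (rule DERIV_cong[OF DERIV_add[OF
          DERIV_mult[OF eta1_powr_tt[OF t c] DERIV_diff[OF DERIV_cmult[OF Z] eta2_over_eta1_t[OF t]]]
          DERIV_mult[OF eta1_powr_t[OF t] DERIV_diff[OF DERIV_cmult[OF eta1_t[OF t]] u2_eta1_t[OF t]]]]])
      (simp add: lam algebra_simps)
qed

end

section \<open>Conservation of angular momentum\<close>

text \<open>
  Reduces statements about derivatives within \<open>J\<close>, which may be unbounded or half-open, to a compact
  interval.  The interval must reach past \<open>t\<close> on each side where \<open>J\<close> does, and it also contains a
  second prescribed time \<open>r\<close>, which will be the initial time.
\<close>

lemma compact_interval_around:
  fixes J :: "real set"
  assumes J: "is_interval J" "interior J \<noteq> {}" and r: "r \<in> J" and t: "t \<in> J"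
  obtains a b where "a < b" "{a..b} \<subseteq> J" "r \<in> {a..b}" "t \<in> {a..b}"
    "at t within J = at t within {a..b}"
proof -
  obtain a where a: "a \<in> J" "a \<le> r" "a \<le> t" "a < t \<or> (\<forall>p\<in>J. t \<le> p)"
  proof (cases "\<exists>p\<in>J. p < t")
    case True
    then obtain p where "p \<in> J" "p < t" by blast
    then show ?thesis using that[of "min r p"] r by (auto simp: min_def)
  next
    case False
    then show ?thesis using that[of t] r t by (auto simp: not_less)
  qed
  obtain b where b: "b \<in> J" "r \<le> b" "t \<le> b" "t < b \<or> (\<forall>q\<in>J. q \<le> t)"
  proof (cases "\<exists>q\<in>J. t < q")
    case True
    then obtain q where "q \<in> J" "t < q" by blast
    then show ?thesis using that[of "max r q"] r by (auto simp: max_def)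
  next
    case False
    then show ?thesis using that[of t] r t by (auto simp: not_less)
  qed
  have "a < b"
  proof (rule ccontr)
    assume "\<not> a < b"
    then have "a = t" "b = t" using a(3) b(3) by linarith+
    then have "J \<subseteq> {t}" using a(4) b(4) by force
    then have "interior J \<subseteq> interior {t}" by (rule interior_mono)
    then show False using J(2) by simp
  qed
  moreover have sub: "{a..b} \<subseteq> J"
    using mem_is_interval_1_I[OF J(1) a(1) b(1)] by auto
  moreover have "at t within J = at t within {a..b}"
  proof (rule at_within_nhd)
    let ?S = "{(if a < t then a else t - 1)<..<(if t < b then b else t + 1)}"
    show "J \<inter> ?S - {t} = {a..b} \<inter> ?S - {t}"
    proof (rule set_eqI)
      fix p
      have "p \<in> {a..b}" if "p \<in> J" "p \<in> ?S"
        using that a b by (cases "a < t"; cases "t < b") force+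
      then show "p \<in> J \<inter> ?S - {t} \<longleftrightarrow> p \<in> {a..b} \<inter> ?S - {t}"
        using sub by blast
    qed
  qed auto
  ultimately show ?thesis using that a b by auto
qed

lemma C2_derivatives:
  assumes "C2 f"
  shows "(f has_real_derivative deriv f \<theta>) (at \<theta>)"
    and "(deriv f has_real_derivative deriv (deriv f) \<theta>) (at \<theta>)"
  using assms
  by (simp_all add: C2_def differentiable_on_def DERIV_deriv_iff_real_differentiable)

lemma partial_t_eqI:
  assumes "((\<lambda>s. f s \<theta>) has_real_derivative d) (at t within J)" "at t within J \<noteq> bot"
  shows "partial_t J f t \<theta> = d"
  using assms unfolding partial_t_def
  by (intro vector_derivative_within) (auto simp: has_real_derivative_iff_has_vector_derivative)

lemma diff_t_derivative:
  assumes "diff_t J f" "t \<in> J"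
  shows "((\<lambda>s. f s \<theta>) has_real_derivative partial_t J f t \<theta>) (at t within J)"
  using assms unfolding diff_t_def partial_t_def
  by (simp add: has_real_derivative_iff_has_vector_derivative vector_derivative_works)

lemma diff_tI:
  assumes "\<And>t \<theta>. t \<in> J \<Longrightarrow> ((\<lambda>s. f s \<theta>) has_real_derivative f' t \<theta>) (at t within J)"
  shows "diff_t J f"
  using assms unfolding diff_t_def by (meson has_field_derivative_imp_has_derivative differentiableI)

theorem corollary6:
  fixes lam \<gamma> \<sigma> :: real
    and J :: "real set"
    and u0 m0 :: "real \<Rightarrow> real"
    and u \<eta> m x y F :: "real \<Rightarrow> real \<Rightarrow> real"
  assumes lambda: "lam \<noteq> 1" and gamma: "\<gamma> = 2 / (lam - 1)"
    and J: "is_interval J" "interior J \<noteq> {}" "0 \<in> J"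
    and u: "mu_solution lam \<sigma> J u"
    and u0: "C2_circle u0" "u 0 = u0"
    and eta: "circle_flow J u \<eta>"
    and m: "\<And>t \<theta>. m t \<theta> = \<sigma> - partial_th (partial_th u) t \<theta>"
    and m0: "\<And>\<theta>. m0 \<theta> = \<sigma> - deriv (deriv u0) \<theta>"
    and F: "\<And>t \<theta>. F t \<theta> =
        (lam - 1) / 2 * (lam * \<sigma> * (partial_t J \<eta> t \<theta> - \<sigma>) + (lam - 3) / 2 * energy u t)"
    and x: "\<And>t \<theta>. x t \<theta> = partial_th \<eta> t \<theta> powr (1 / \<gamma>)"
    and y: "\<And>t \<theta>. y t \<theta> =
        - \<gamma> * partial_th x t \<theta> + \<sigma> * x t \<theta> * (LBINT \<tau>=0..t. x \<tau> \<theta> powr \<gamma>)"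
  shows "diff_t J x \<and> diff_t J (partial_t J x) \<and>
    diff_t J y \<and> diff_t J (partial_t J y) \<and>
    (\<forall>t\<in>J. \<forall>\<theta>.
      partial_t J (partial_t J x) t \<theta> = F t \<theta> * x t \<theta> \<and>
      partial_t J (partial_t J y) t \<theta> = F t \<theta> * y t \<theta> \<and>
      x t \<theta> * partial_t J y t \<theta> - y t \<theta> * partial_t J x t \<theta>
        = partial_th \<eta> t \<theta> powr lam * m t (\<eta> t \<theta>) \<and>
      partial_th \<eta> t \<theta> powr lam * m t (\<eta> t \<theta>) = m0 \<theta>)"
proof -
  define c where "c = (lam - 1) / 2"
  have c: "1 / \<gamma> = c" and \<gamma>c: "\<gamma> * c = 1" and "\<gamma> \<noteq> 0"
    using lambda by (auto simp: gamma c_def)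
  let ?u1 = "partial_th u" and ?u2 = "partial_th (partial_th u)"
    and ?\<eta>1 = "partial_th \<eta>" and ?\<eta>2 = "partial_th (partial_th \<eta>)"
  have partial_th_eq: "partial_th f t = deriv (f t)" for f t
    by (simp add: partial_th_def fun_eq_iff)
  define I where "I t = (lam - 3) / 2 * energy u t - lam * \<sigma>\<^sup>2" for t
  define Z where "Z t \<theta> = (LBINT \<tau>=0..t. x \<tau> \<theta> powr \<gamma>)" for t \<theta>
  define xt where "xt t \<theta> = c * ?u1 t (\<eta> t \<theta>) * ?\<eta>1 t \<theta> powr c" for t \<theta>
  define yt where "yt t \<theta> = c * ?u1 t (\<eta> t \<theta>) * ?\<eta>1 t \<theta> powr c * (\<sigma> * Z t \<theta> - ?\<eta>2 t \<theta> / ?\<eta>1 t \<theta>)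
      + ?\<eta>1 t \<theta> powr c * (\<sigma> * ?\<eta>1 t \<theta> - ?u2 t (\<eta> t \<theta>) * ?\<eta>1 t \<theta>)" for t \<theta>
  have x': "x t \<theta> = ?\<eta>1 t \<theta> powr c" for t \<theta> by (simp add: x c)

  have u_C2: "C2 (u t)" and u_per: "u t (\<theta> + 1) = u t \<theta>" if "t \<in> J" for t \<theta>
    using u that by (auto simp: mu_solution_def C2_circle_def)
  have eta_C2: "C2 (\<eta> t)" and eta1_pos: "?\<eta>1 t \<theta> > 0"
    and eta_t: "((\<lambda>s. \<eta> s \<theta>) has_real_derivative u t (\<eta> t \<theta>)) (at t within J)" if "t \<in> J" for t \<theta>
    using eta that by (auto simp: circle_flow_def C2_circle_diffeo_def)
  have u_th: "(u t has_real_derivative ?u1 t \<theta>) (at \<theta>)"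
    and u1_th: "(?u1 t has_real_derivative ?u2 t \<theta>) (at \<theta>)"
    and eta_th: "(\<eta> t has_real_derivative ?\<eta>1 t \<theta>) (at \<theta>)"
    and eta1_th: "(?\<eta>1 t has_real_derivative ?\<eta>2 t \<theta>) (at \<theta>)" if "t \<in> J" for t \<theta>
    using C2_derivatives[OF u_C2[OF that]] C2_derivatives[OF eta_C2[OF that]]
    by (simp_all add: partial_th_eq)
  have u1_t: "((\<lambda>s. ?u1 s \<theta>) has_real_derivative
      I t + lam * \<sigma> * u t \<theta> - (lam - 1) / 2 * (?u1 t \<theta>)\<^sup>2 - u t \<theta> * ?u2 t \<theta>) (at t within J)"
    if t: "t \<in> J" for t \<theta>
  proof -
    have "diff_t J ?u1" and pde: "partial_t J ?u1 t \<theta> + u t \<theta> * ?u2 t \<theta>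
        + (lam - 1) / 2 * (?u1 t \<theta>)\<^sup>2 - lam * \<sigma> * u t \<theta> = I t"
      using u t by (auto simp: mu_solution_def I_def)
    then have "((\<lambda>s. ?u1 s \<theta>) has_real_derivative partial_t J ?u1 t \<theta>) (at t within J)"
      using t by (intro diff_t_derivative)
    then show ?thesis by (rule DERIV_cong) (use pde in linarith)
  qed

  \<comment> \<open>\<open>F\<close> is the coefficient that the linearised Riccati equation produces.\<close>
  have F': "F t \<theta> = c * (I t + lam * \<sigma> * u t (\<eta> t \<theta>))"
    if "t \<in> J" "at t within J \<noteq> bot" for t \<theta>
  proof -
    have "partial_t J \<eta> t \<theta> = u t (\<eta> t \<theta>)"
      using eta_t that by (intro partial_t_eqI)
    then show ?thesis by (simp add: F I_def c_def[symmetric] algebra_simps power2_eq_square)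
  qed
  \<comment> \<open>As \<open>\<gamma> c = 1\<close>, the space derivative of \<open>x\<close> is \<open>x\<close> times a logarithmic derivative of \<open>\<eta>\<^sub>\<theta>\<close>.\<close>
  have y': "y t \<theta> = ?\<eta>1 t \<theta> powr c * (\<sigma> * Z t \<theta> - ?\<eta>2 t \<theta> / ?\<eta>1 t \<theta>)" if t: "t \<in> J" for t \<theta>
  proof -
    have "(x t has_real_derivative c * ?\<eta>1 t \<theta> powr (c - 1) * ?\<eta>2 t \<theta>) (at \<theta>)"
      using DERIV_chain2[OF has_real_derivative_powr[OF eta1_pos[OF t]] eta1_th[OF t]]
      by (simp add: x'[abs_def])
    then have "partial_th x t \<theta> = c * ?\<eta>1 t \<theta> powr (c - 1) * ?\<eta>2 t \<theta>"
      by (simp add: partial_th_eq DERIV_imp_deriv)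
    then have "\<gamma> * partial_th x t \<theta> = (\<gamma> * c) * (?\<eta>1 t \<theta> powr c * ?\<eta>2 t \<theta> / ?\<eta>1 t \<theta>)"
      using eta1_pos[OF t, of \<theta>] by (simp add: powr_diff)
    moreover have "y t \<theta> = - (\<gamma> * partial_th x t \<theta>) + \<sigma> * x t \<theta> * Z t \<theta>"
      by (simp add: y Z_def)
    ultimately show ?thesis
      by (simp add: \<gamma>c x'[of t \<theta>] right_diff_distrib)
  qed

  have main: "at t within J \<noteq> bot \<and>
      ((\<lambda>s. x s \<theta>) has_real_derivative xt t \<theta>) (at t within J) \<and>
      ((\<lambda>s. xt s \<theta>) has_real_derivative F t \<theta> * x t \<theta>) (at t within J) \<and>
      ((\<lambda>s. y s \<theta>) has_real_derivative yt t \<theta>) (at t within J) \<and>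
      ((\<lambda>s. yt s \<theta>) has_real_derivative F t \<theta> * y t \<theta>) (at t within J) \<and>
      ?\<eta>1 t \<theta> powr lam * m t (\<eta> t \<theta>) = m0 \<theta>" if t: "t \<in> J" for t \<theta>
  proof -
    obtain a b where ab: "a < b" "{a..b} \<subseteq> J" "0 \<in> {a..b}" "t \<in> {a..b}"
      and at_eq: "at t within J = at t within {a..b}"
      using compact_interval_around[OF J t] by blast
    have inJ: "s \<in> J" if "s \<in> {a..b}" for s using ab(2) that by blast
    have cont: "continuous_on ({a..b} \<times> UNIV) f" if "continuous_on (J \<times> UNIV) f"
      for f :: "real \<times> real \<Rightarrow> real"
      using ab(2) by (intro continuous_on_subset[OF that]) auto
    interpret flow: smooth_circle_flow a b lam \<sigma> I u ?u1 ?u2 \<eta> ?\<eta>1 ?\<eta>2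
    proof
      show "continuous_on ({a..b} \<times> UNIV) (\<lambda>(t, \<theta>). u t \<theta>)"
        "continuous_on ({a..b} \<times> UNIV) (\<lambda>(t, \<theta>). ?u1 t \<theta>)"
        "continuous_on ({a..b} \<times> UNIV) (\<lambda>(t, \<theta>). ?u2 t \<theta>)"
        using u by (auto simp: mu_solution_def intro!: cont)
    qed (rule u_per u_th u1_th eta_th eta1_th eta1_pos
        DERIV_subset[OF u1_t ab(2)] DERIV_subset[OF eta_t ab(2)]; rule inJ; assumption)+
    have nontrivial: "at t within J \<noteq> bot"
      using ab(1,4) unfolding at_eq by (simp add: trivial_limit_within)
    have x_powr: "x s \<theta> powr \<gamma> = ?\<eta>1 s \<theta>" if "s \<in> {a..b}" for s
      using eta1_pos[OF inJ[OF that], of \<theta>] \<gamma>c by (simp add: x' powr_powr mult.commute)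
    have "continuous_on {a..b} (\<lambda>s. ?\<eta>1 s \<theta>)"
      by (rule DERIV_continuous_on) (rule flow.eta1_t)
    then have "continuous_on {a..b} (\<lambda>s. x s \<theta> powr \<gamma>)"
      by (rule continuous_on_eq) (simp add: x_powr)
    then have "((\<lambda>s. LBINT \<tau>=ereal 0..ereal s. x \<tau> \<theta> powr \<gamma>) has_vector_derivative x t \<theta> powr \<gamma>)
        (at t within {a..b})"
      using ab by (intro interval_integral_FTC2) auto
    then have Z: "((\<lambda>s. Z s \<theta>) has_real_derivative ?\<eta>1 t \<theta>) (at t within {a..b})"
      by (simp add: Z_def x_powr[OF ab(4)] has_real_derivative_iff_has_vector_derivative zero_ereal_def)
    \<comment> \<open>The formula for \<open>y\<close> holds at times in \<open>J\<close> only, hence the passage to an equal function there.\<close>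
    have "((\<lambda>s. y s \<theta>) has_real_derivative yt t \<theta>) (at t within {a..b})"
      unfolding yt_def
      by (rule has_field_derivative_transform_within[OF flow.second_solution_t[OF ab(4) Z] zero_less_one ab(4)])
        (rule y'[OF inJ, symmetric])
    moreover have "?\<eta>1 t \<theta> powr lam * m t (\<eta> t \<theta>) = m0 \<theta>"
    proof -
      have "\<eta> 0 = (\<lambda>\<theta>. \<theta>)" using eta by (auto simp: circle_flow_def)
      then have "?\<eta>1 0 \<theta> = 1" "\<eta> 0 \<theta> = \<theta>" by (simp_all add: partial_th_eq)
      then show ?thesis
        using flow.transported_momentum_constant[OF ab(4,3), of \<theta>] u0(2)
        by (simp add: m m0 partial_th_eq)
    qed
    ultimately show ?thesis
      using flow.eta1_powr_t[OF ab(4), of \<theta> c] flow.eta1_powr_tt[OF ab(4) c_def, of \<theta>]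
        flow.second_solution_tt[OF ab(4) c_def Z] nontrivial
      by (simp add: F'[OF t nontrivial] x' y'[OF t] xt_def yt_def at_eq)
  qed

  have pt_x: "partial_t J x t \<theta> = xt t \<theta>" and pt_y: "partial_t J y t \<theta> = yt t \<theta>"
    if "t \<in> J" for t \<theta>
    using main[OF that, of \<theta>] by (simp_all add: partial_t_eqI)
  have pt_xt: "((\<lambda>s. partial_t J x s \<theta>) has_real_derivative F t \<theta> * x t \<theta>) (at t within J)"
    if t: "t \<in> J" for t \<theta>
  proof (rule has_field_derivative_transform_within[OF _ zero_less_one t])
    show "((\<lambda>s. xt s \<theta>) has_real_derivative F t \<theta> * x t \<theta>) (at t within J)"
      using main[OF t, of \<theta>] by blast
  qed (rule pt_x[symmetric])
  have pt_yt: "((\<lambda>s. partial_t J y s \<theta>) has_real_derivative F t \<theta> * y t \<theta>) (at t within J)"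
    if t: "t \<in> J" for t \<theta>
  proof (rule has_field_derivative_transform_within[OF _ zero_less_one t])
    show "((\<lambda>s. yt s \<theta>) has_real_derivative F t \<theta> * y t \<theta>) (at t within J)"
      using main[OF t, of \<theta>] by blast
  qed (rule pt_y[symmetric])
  have momentum: "x t \<theta> * yt t \<theta> - y t \<theta> * xt t \<theta> = ?\<eta>1 t \<theta> powr lam * m t (\<eta> t \<theta>)"
    if t: "t \<in> J" for t \<theta>
  proof -
    have "x t \<theta> * yt t \<theta> - y t \<theta> * xt t \<theta>
        = ?\<eta>1 t \<theta> powr c * ?\<eta>1 t \<theta> powr c * ?\<eta>1 t \<theta> * m t (\<eta> t \<theta>)"
      by (simp add: x' y'[OF t] xt_def yt_def m algebra_simps)
    also have "?\<eta>1 t \<theta> powr c * ?\<eta>1 t \<theta> powr c = ?\<eta>1 t \<theta> powr (lam - 1)"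
      by (simp add: c_def flip: powr_add)
    also have "?\<eta>1 t \<theta> powr (lam - 1) * ?\<eta>1 t \<theta> = ?\<eta>1 t \<theta> powr lam"
      using eta1_pos[OF t, of \<theta>] by (simp add: powr_diff)
    finally show ?thesis .
  qed
  have "diff_t J x"
    by (rule diff_tI[where f' = xt]) (simp add: main)
  moreover have "diff_t J y"
    by (rule diff_tI[where f' = yt]) (simp add: main)
  moreover have "diff_t J (partial_t J x)"
    by (rule diff_tI) (rule pt_xt)
  moreover have "diff_t J (partial_t J y)"
    by (rule diff_tI) (rule pt_yt)
  moreover have "partial_t J (partial_t J x) t \<theta> = F t \<theta> * x t \<theta>"
    and "partial_t J (partial_t J y) t \<theta> = F t \<theta> * y t \<theta>" if "t \<in> J" for t \<theta>
    using main[OF that, of \<theta>] pt_xt[OF that] pt_yt[OF that] by (simp_all add: partial_t_eqI)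
  ultimately show ?thesis
    using main momentum by (simp add: pt_x pt_y)
qed

end
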